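(* Let $\mathcal{H}$ be a separable infinite-dimensional complex Hilbert space and let $\mathcal{L}$ be an infinite-dimensional, nonabelian Lie algebra of compact operators on $\mathcal{H}$. If there exists $T \in \mathcal{L}$ such that the principal two-sided ideal $(T)$ of $\mathcal{B}(\mathcal{H})$ generated by $T$ is not a soft ideal, then $\mathcal{L}$ is not simple.
   Context: $\mathcal{B}(\mathcal{H})$ is the algebra of bounded operators on $\mathcal{H}$ and $\mathcal{K}(\mathcal{H})$ its ideal of compact operators. A Lie algebra of compact operators is a complex linear subspace $\mathcal{L}\subset\mathcal{K}(\mathcal{H})$ closed under $[A,B]=AB-BA$. It is nonabelian if $[A,B]\neq 0$ for some $A,B\in\mathcal{L}$. A Lie ideal of $\mathcal{L}$ is a linear subspace $\mathcal{J}\subset\mathcal{L}$ with $[A,B]\in\mathcal{J}$ whenever $A\in\mathcal{L}$, $B\in\mathcal{J}$ (no topological closedness is required). $\mathcal{L}$ is simple if its only Lie ideals are $\{0\}$ and $\mathcal{L}$. For two-sided ideals $\mathcal{I},\mathcal{J}$ of $\mathcal{B}(\mathcal{H})$, the product $\mathcal{I}\mathcal{J}$ is the two-sided ideal of finite sums of products $XY$ with $X\in\mathcal{I}$, $Y\in\mathcal{J}$. A two-sided ideal $\mathcal{I}$ of $\mathcal{B}(\mathcal{H})$ is called soft (soft-edged) if $\mathcal{I}=\mathcal{I}\,\mathcal{K}(\mathcal{H})$. *)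

theory Defs
  imports "HOL-Analysis.Analysis"
begin

class complex_vector = real_vector +
  fixes scaleC :: "complex \<Rightarrow> 'a \<Rightarrow> 'a"  (infixr \<open>*\<^sub>C\<close> 75)
  assumes scaleC_add_right: "c *\<^sub>C (x + y) = c *\<^sub>C x + c *\<^sub>C y"
    and scaleC_add_left: "(c + d) *\<^sub>C x = c *\<^sub>C x + d *\<^sub>C x"
    and scaleC_scaleC: "c *\<^sub>C d *\<^sub>C x = (c * d) *\<^sub>C x"
    and scaleC_one: "1 *\<^sub>C x = x"
    and scaleR_scaleC: "r *\<^sub>R x = complex_of_real r *\<^sub>C x"

global_interpretation complex_vector: vector_space "scaleC :: complex \<Rightarrow> 'a \<Rightarrow> 'a::complex_vector"
  defines csubspace = complex_vector.subspace
    and cspan = complex_vector.span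
  by unfold_locales (simp_all add: scaleC_add_right scaleC_add_left scaleC_scaleC scaleC_one)

definition infinite_cdim :: "'a::complex_vector set \<Rightarrow> bool"
  where "infinite_cdim V \<longleftrightarrow> \<not> (\<exists>B. finite B \<and> V \<subseteq> cspan B)"

text \<open>The inner product is linear in its first argument. The axiom \<open>cinner_self\<close> contains positive
  definiteness and says that the norm is the one induced by the inner product.\<close>

class complex_inner = complex_vector + real_normed_vector +
  fixes cinner :: "'a \<Rightarrow> 'a \<Rightarrow> complex"
  assumes cinner_commute: "cinner x y = cnj (cinner y x)"
    and cinner_add_left: "cinner (x + y) z = cinner x z + cinner y z"
    and cinner_scaleC_left: "cinner (c *\<^sub>C x) y = c * cinner x y"
    and cinner_self: "cinner x x = complex_of_real ((norm x)\<^sup>2)"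

class chilbert_space = complex_inner + banach

lemma norm_scaleC: "norm (c *\<^sub>C x) = cmod c * norm (x::'a::complex_inner)"
proof -
  have "complex_of_real ((norm (c *\<^sub>C x))\<^sup>2) = c * cnj (c * cinner x x)"
    by (metis cinner_self cinner_scaleC_left cinner_commute)
  also have "\<dots> = (c * cnj c) * complex_of_real ((norm x)\<^sup>2)"
    by (simp add: cinner_self)
  also have "c * cnj c = complex_of_real ((cmod c)\<^sup>2)"
    by (metis complex_norm_square)
  also have "complex_of_real ((cmod c)\<^sup>2) * complex_of_real ((norm x)\<^sup>2) =
      complex_of_real ((cmod c * norm x)\<^sup>2)"
    by (simp add: power_mult_distrib)
  finally have "(norm (c *\<^sub>C x))\<^sup>2 = (cmod c * norm x)\<^sup>2"
    using of_real_eq_iff by blast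
  then show ?thesis
    by (simp add: power2_eq_iff_nonneg)
qed

lemma bounded_linear_scaleC: "bounded_linear (\<lambda>x::'a::complex_inner. c *\<^sub>C x)"
  by (rule bounded_linear_intro[where K = "cmod c"])
    (simp_all add: scaleC_add_right scaleR_scaleC scaleC_scaleC norm_scaleC mult.commute)

instantiation blinfun :: (real_normed_vector, complex_inner) complex_vector
begin

lift_definition scaleC_blinfun :: "complex \<Rightarrow> ('a \<Rightarrow>\<^sub>L 'b) \<Rightarrow> 'a \<Rightarrow>\<^sub>L 'b"
  is "\<lambda>c f x. c *\<^sub>C f x"
  by (rule bounded_linear_compose[OF bounded_linear_scaleC])

instance
  by standard
    (transfer; simp add: fun_eq_iff scaleC_add_right scaleC_add_left scaleC_scaleC scaleC_one
      scaleR_scaleC)+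

end

text \<open>The elements of the type \<open>'a \<Rightarrow>\<^sub>L 'a\<close> are the bounded \<^emph>\<open>real\<close>-linear operators; the algebra of
  bounded operators of the complex space consists of the complex-linear ones.\<close>

definition bounded_ops :: "('a::chilbert_space \<Rightarrow>\<^sub>L 'a) set"
  where "bounded_ops = {A. \<forall>c x. blinfun_apply A (c *\<^sub>C x) = c *\<^sub>C blinfun_apply A x}"

definition compact_ops :: "('a::chilbert_space \<Rightarrow>\<^sub>L 'a) set"
  where "compact_ops = {A \<in> bounded_ops. compact (closure (blinfun_apply A ` cball 0 1))}"

definition commutator :: "('a::chilbert_space \<Rightarrow>\<^sub>L 'a) \<Rightarrow> ('a \<Rightarrow>\<^sub>L 'a) \<Rightarrow> 'a \<Rightarrow>\<^sub>L 'a"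
  where "commutator A B = (A o\<^sub>L B) - (B o\<^sub>L A)"

definition lie_algebra_of_compact_ops :: "('a::chilbert_space \<Rightarrow>\<^sub>L 'a) set \<Rightarrow> bool"
  where "lie_algebra_of_compact_ops L \<longleftrightarrow>
    csubspace L \<and> L \<subseteq> compact_ops \<and> (\<forall>A\<in>L. \<forall>B\<in>L. commutator A B \<in> L)"

definition nonabelian :: "('a::chilbert_space \<Rightarrow>\<^sub>L 'a) set \<Rightarrow> bool"
  where "nonabelian L \<longleftrightarrow> (\<exists>A\<in>L. \<exists>B\<in>L. commutator A B \<noteq> 0)"

definition lie_ideal :: "('a::chilbert_space \<Rightarrow>\<^sub>L 'a) set \<Rightarrow> ('a \<Rightarrow>\<^sub>L 'a) set \<Rightarrow> bool"
  where "lie_ideal J L \<longleftrightarrow>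
    csubspace J \<and> J \<subseteq> L \<and> (\<forall>A\<in>L. \<forall>B\<in>J. commutator A B \<in> J)"

definition lie_simple :: "('a::chilbert_space \<Rightarrow>\<^sub>L 'a) set \<Rightarrow> bool"
  where "lie_simple L \<longleftrightarrow> (\<forall>J. lie_ideal J L \<longrightarrow> J = {0} \<or> J = L)"

definition two_sided_ideal :: "('a::chilbert_space \<Rightarrow>\<^sub>L 'a) set \<Rightarrow> bool"
  where "two_sided_ideal I \<longleftrightarrow>
    csubspace I \<and> I \<subseteq> bounded_ops \<and>
    (\<forall>A\<in>bounded_ops. \<forall>X\<in>I. (A o\<^sub>L X) \<in> I \<and> (X o\<^sub>L A) \<in> I)"

definition principal_ideal :: "('a::chilbert_space \<Rightarrow>\<^sub>L 'a) \<Rightarrow> ('a \<Rightarrow>\<^sub>L 'a) set"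
  where "principal_ideal T = two_sided_ideal hull {T}"

definition ideal_product ::
    "('a::chilbert_space \<Rightarrow>\<^sub>L 'a) set \<Rightarrow> ('a \<Rightarrow>\<^sub>L 'a) set \<Rightarrow> ('a \<Rightarrow>\<^sub>L 'a) set"
  where "ideal_product I J =
    {(\<Sum>k<n. X k o\<^sub>L Y k) | (n::nat) X Y. \<forall>k<n. X k \<in> I \<and> Y k \<in> J}"

definition soft_ideal :: "('a::chilbert_space \<Rightarrow>\<^sub>L 'a) set \<Rightarrow> bool"
  where "soft_ideal I \<longleftrightarrow> two_sided_ideal I \<and> I = ideal_product I compact_ops"

lemma two_sided_ideal_principal_ideal:
  assumes "T \<in> bounded_ops"
  shows "two_sided_ideal (principal_ideal T)"
proof -
  have "two_sided_ideal (bounded_ops :: ('a \<Rightarrow>\<^sub>L 'a) set)"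
    unfolding two_sided_ideal_def complex_vector.subspace_def
    by (auto simp: bounded_ops_def blinfun.add_left scaleC_blinfun.rep_eq scaleC_add_right
        scaleC_scaleC mult.commute)
  then have "principal_ideal T \<subseteq> bounded_ops"
    unfolding principal_ideal_def using assms by (simp add: hull_minimal)
  moreover have "csubspace (principal_ideal T)"
    unfolding principal_ideal_def hull_def
    by (rule complex_vector.subspace_Inter) (simp add: two_sided_ideal_def)
  moreover have "(A o\<^sub>L X) \<in> principal_ideal T \<and> (X o\<^sub>L A) \<in> principal_ideal T"
    if "A \<in> bounded_ops" "X \<in> principal_ideal T" for A X
    using that by (simp add: principal_ideal_def hull_def two_sided_ideal_def)
  ultimately show ?thesis
    by (simp add: two_sided_ideal_def)
qed

text \<open>By the previous lemma, for \<^term>\<open>principal_ideal T\<close> with \<open>T\<close> bounded, not being soft means only that the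
  second conjunct of \<^const>\<open>soft_ideal\<close> fails.\<close>

end

theory Submission
  imports Defs
begin

text \<open>If \<open>(T)\<close> is not soft, then \<open>T\<close> lies outside the two-sided ideal \<open>S = (T) K(H)\<close>, so in a simple \<open>L\<close>
  the Lie ideal \<open>L \<inter> S\<close> is zero. For \<open>A \<in> L\<close> both \<open>TA\<close> and \<open>AT\<close> lie in \<open>S\<close>, hence \<open>[A, T] = 0\<close>, and the
  center of \<open>L\<close> is a nonzero Lie ideal, so \<open>L\<close> is abelian.

  The point is \<open>AT \<in> (T) K(H)\<close> for compact \<open>A\<close> and \<open>T\<close>. Let \<open>e\<^sub>i\<close> be the right singular vectors of \<open>T\<close>
  and \<open>f\<^sub>i\<close> the normalised images \<open>T e\<^sub>i\<close>. As \<open>A\<close> is compact, it is small on far tails of \<open>(f\<^sub>i)\<close>, so the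
  indices split into consecutive finite blocks \<open>B\<^sub>j\<close> such that \<open>A\<close> has norm of order \<open>4\<^sup>-\<^sup>j\<close> on the span of
  the \<open>f\<^sub>i\<close> with \<open>i \<in> B\<^sub>j\<close>. Then \<open>AT = ZTK\<close>, where \<open>Z\<close> is \<open>2\<^sup>j A\<close> on the \<open>j\<close>-th block of the \<open>f\<^sub>i\<close> and
  the compact operator \<open>K\<close> is \<open>2\<^sup>-\<^sup>j\<close> on the \<open>j\<close>-th block of the \<open>e\<^sub>i\<close>.\<close>

section \<open>Inner products and orthonormal families\<close>

lemma cinner_add_right: "cinner x (y + z) = cinner x y + cinner x (z::'a::complex_inner)"
  by (metis cinner_commute cinner_add_left complex_cnj_add)

lemma cinner_scaleC_right: "cinner x (c *\<^sub>C y) = cnj c * cinner x (y::'a::complex_inner)"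
  by (metis cinner_commute cinner_scaleC_left complex_cnj_mult)

lemma cinner_zero_left [simp]: "cinner 0 (x::'a::complex_inner) = 0"
  using cinner_add_left[of 0 0 x] by simp

lemma cinner_zero_right [simp]: "cinner (x::'a::complex_inner) 0 = 0"
  using cinner_add_right[of x 0 0] by simp

lemma cinner_diff_left: "cinner (x - y) z = cinner x z - cinner y (z::'a::complex_inner)"
  using cinner_add_left[of "x - y" y z] by simp

lemma cinner_sum_left: "cinner (\<Sum>i\<in>S. f i) z = (\<Sum>i\<in>S. cinner (f i) (z::'a::complex_inner))"
  by (induction S rule: infinite_finite_induct) (simp_all add: cinner_add_left)

lemma cinner_sum_right: "cinner z (\<Sum>i\<in>S. f i) = (\<Sum>i\<in>S. cinner z (f i :: 'a::complex_inner))"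
  by (induction S rule: infinite_finite_induct) (simp_all add: cinner_add_right)

lemma cinner_eq_0_commute: "cinner x y = 0 \<longleftrightarrow> cinner y (x::'a::complex_inner) = 0"
  by (metis cinner_commute complex_cnj_zero)

lemma norm_add_cinner:
  "(norm (x + y))\<^sup>2 = (norm x)\<^sup>2 + (norm y)\<^sup>2 + 2 * Re (cinner x (y::'a::complex_inner))"
proof -
  have "complex_of_real ((norm (x + y))\<^sup>2) = cinner (x + y) (x + y)"
    by (simp add: cinner_self)
  also have "\<dots> = cinner x x + cinner y y + (cinner x y + cnj (cinner x y))"
    by (simp add: cinner_add_left cinner_add_right cinner_commute[of y x])
  also have "\<dots> = complex_of_real ((norm x)\<^sup>2 + (norm y)\<^sup>2 + 2 * Re (cinner x y))"
    by (simp add: cinner_self complex_add_cnj)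
  finally show ?thesis
    using of_real_eq_iff by blast
qed

lemma pythagoras: "cinner x y = 0 \<Longrightarrow> (norm (x + y))\<^sup>2 = (norm x)\<^sup>2 + (norm (y::'a::complex_inner))\<^sup>2"
  by (simp add: norm_add_cinner)

lemma parallelogram_law:
  "(norm (x + y))\<^sup>2 + (norm (x - y))\<^sup>2 = 2 * (norm x)\<^sup>2 + 2 * (norm (y::'a::complex_inner))\<^sup>2"
  using norm_add_cinner[of x y] norm_add_cinner[of "x - y" y]
  by (simp add: cinner_diff_left cinner_self)

lemma cinner_Cauchy_Schwarz: "cmod (cinner x y) \<le> norm x * norm (y::'a::complex_inner)"
proof (cases "y = 0")
  case False
  \<comment> \<open>\<open>c *\<^sub>C y\<close> is the orthogonal projection of \<open>x\<close>
    onto the line through \<open>y\<close>; Pythagoras bounds its norm by that of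
    \<open>x\<close>.\<close>
  define c where "c = cinner x y / complex_of_real ((norm y)\<^sup>2)"
  have c: "c * cinner y y = cinner x y"
    using False by (simp add: c_def cinner_self)
  have "cinner (x - c *\<^sub>C y) (c *\<^sub>C y) = 0"
    by (simp add: cinner_scaleC_right cinner_diff_left cinner_scaleC_left c)
  then have "(norm (x - c *\<^sub>C y + c *\<^sub>C y))\<^sup>2 = (norm (x - c *\<^sub>C y))\<^sup>2 + (norm (c *\<^sub>C y))\<^sup>2"
    by (rule pythagoras)
  then have "(norm (c *\<^sub>C y))\<^sup>2 \<le> (norm x)\<^sup>2"
    by simp
  then have "cmod c * norm y \<le> norm x"
    by (metis norm_scaleC power2_le_imp_le norm_ge_zero)
  then have "cmod c * norm y * norm y \<le> norm x * norm y"
    by (rule mult_right_mono) simp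
  moreover have "cmod (cinner x y) = cmod c * norm y * norm y"
    using arg_cong[OF c, of cmod]
    by (simp only: cinner_self norm_mult norm_of_real) (simp add: power2_eq_square mult.assoc)
  ultimately show ?thesis
    by simp
qed simp

text \<open>The index set is a parameter so that one notion covers initial segments, blocks of
  indices and the whole sequence.\<close>

definition orthonormal_on :: "nat set \<Rightarrow> (nat \<Rightarrow> 'a::complex_inner) \<Rightarrow> bool"
  where "orthonormal_on S e \<longleftrightarrow> (\<forall>i\<in>S. \<forall>j\<in>S. cinner (e i) (e j) = (if i = j then 1 else 0))"

lemma orthonormal_on_subset: "orthonormal_on S e \<Longrightarrow> R \<subseteq> S \<Longrightarrow> orthonormal_on R e"
  unfolding orthonormal_on_def by blast

lift_definition rank_one :: "'a::complex_inner \<Rightarrow> 'a \<Rightarrow>\<^sub>L 'a" is "\<lambda>v x. cinner x v *\<^sub>C v"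
proof (rule bounded_linear_intro)
  fix v x :: 'a
  show "norm (cinner x v *\<^sub>C v) \<le> norm x * (norm v * norm v)"
    using mult_right_mono[OF cinner_Cauchy_Schwarz[of x v], of "norm v"]
    by (simp add: norm_scaleC mult.assoc)
qed (simp_all add: cinner_add_left scaleC_add_left scaleR_scaleC cinner_scaleC_left scaleC_scaleC)

text \<open>For finite \<open>S\<close> and \<open>e\<close> orthonormal on \<open>S\<close> this is
  the orthogonal projection onto the span of the \<open>e k\<close> with \<open>k\<close> in
  \<open>S\<close>. For infinite \<open>S\<close> the sum is 0 by convention.\<close>

definition oproj :: "nat set \<Rightarrow> (nat \<Rightarrow> 'a::complex_inner) \<Rightarrow> 'a \<Rightarrow>\<^sub>L 'a"
  where "oproj S e = (\<Sum>k\<in>S. rank_one (e k))"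

lemma oproj_apply: "oproj S e x = (\<Sum>k\<in>S. cinner x (e k) *\<^sub>C e k)"
  by (simp add: oproj_def blinfun.sum_left rank_one.rep_eq)

lemma cinner_oproj_left: "cinner (oproj S e x) y = (\<Sum>k\<in>S. cinner x (e k) * cinner (e k) y)"
  by (simp add: oproj_apply cinner_sum_left cinner_scaleC_left)

lemma cinner_oproj_right: "cinner x (oproj S e y) = (\<Sum>k\<in>S. cnj (cinner y (e k)) * cinner x (e k))"
  by (simp add: oproj_apply cinner_sum_right cinner_scaleC_right)

lemma oproj_selfadjoint: "cinner (oproj S e x) y = cinner x (oproj S e y)"
proof -
  have "cinner x (oproj S e y) = (\<Sum>k\<in>S. cnj (cinner y (e k)) * cinner x (e k))"
    by (rule cinner_oproj_right)
  also have "\<dots> = (\<Sum>k\<in>S. cinner x (e k) * cinner (e k) y)"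
    by (metis (no_types, lifting) cinner_commute mult.commute sum.cong)
  finally show ?thesis
    by (simp add: cinner_oproj_left)
qed

context
  fixes S :: "nat set" and e :: "nat \<Rightarrow> 'a::complex_inner"
  assumes fin: "finite S" and orth: "orthonormal_on S e"
begin

lemma cinner_oproj_basis: "j \<in> S \<Longrightarrow> cinner (oproj S e x) (e j) = cinner x (e j)"
proof -
  assume j: "j \<in> S"
  have "cinner (oproj S e x) (e j) = (\<Sum>k\<in>S. if k = j then cinner x (e k) else 0)"
    unfolding cinner_oproj_left
    by (intro sum.cong refl) (use orth j in \<open>auto simp: orthonormal_on_def\<close>)
  then show ?thesis
    using fin j by simp
qed

lemma cinner_oproj_diff: "j \<in> S \<Longrightarrow> cinner (x - oproj S e x) (e j) = 0"
  by (simp add: cinner_diff_left cinner_oproj_basis)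

lemma norm_oproj: "(norm (oproj S e x))\<^sup>2 = (\<Sum>k\<in>S. (cmod (cinner x (e k)))\<^sup>2)"
proof -
  have "complex_of_real ((norm (oproj S e x))\<^sup>2) =
      (\<Sum>k\<in>S. cinner x (e k) * cinner (e k) (oproj S e x))"
    by (simp only: cinner_self[symmetric] cinner_oproj_left)
  also have "\<dots> = (\<Sum>k\<in>S. cinner x (e k) * cnj (cinner x (e k)))"
    by (intro sum.cong refl) (metis cinner_commute cinner_oproj_basis)
  also have "\<dots> = complex_of_real (\<Sum>k\<in>S. (cmod (cinner x (e k)))\<^sup>2)"
    by (simp only: complex_norm_square of_real_sum)
  finally show ?thesis
    using of_real_eq_iff by blast
qed

lemma norm_oproj_split: "(norm x)\<^sup>2 = (norm (oproj S e x))\<^sup>2 + (norm (x - oproj S e x))\<^sup>2"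
proof -
  have "cinner (x - oproj S e x) (oproj S e x) = 0"
    by (simp add: cinner_oproj_right cinner_oproj_diff)
  then have "(norm (x - oproj S e x + oproj S e x))\<^sup>2 =
      (norm (x - oproj S e x))\<^sup>2 + (norm (oproj S e x))\<^sup>2"
    by (rule pythagoras)
  then show ?thesis
    by simp
qed

lemma norm_oproj_le: "norm (oproj S e x) \<le> norm x"
  using norm_oproj_split[of x] by (simp add: power2_le_imp_le)

lemma norm_oproj_diff_le: "norm (x - oproj S e x) \<le> norm x"
  using norm_oproj_split[of x] by (simp add: power2_le_imp_le)

lemma bessel_inequality: "(\<Sum>k\<in>S. (cmod (cinner x (e k)))\<^sup>2) \<le> (norm x)\<^sup>2"
  using norm_oproj_split[of x] norm_oproj[of x] by simp

end

section \<open>Compact operators\<close>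

lemma bounded_ops_scaleC: "A \<in> bounded_ops \<Longrightarrow> A (c *\<^sub>C x) = c *\<^sub>C A x"
  by (simp add: bounded_ops_def)

lemma csubspace_bounded_ops: "csubspace (bounded_ops :: ('a::chilbert_space \<Rightarrow>\<^sub>L 'a) set)"
  unfolding complex_vector.subspace_def
  by (auto simp: bounded_ops_def blinfun.add_left scaleC_blinfun.rep_eq scaleC_add_right
      scaleC_scaleC mult.commute)

lemma compose_in_bounded_ops: "A \<in> bounded_ops \<Longrightarrow> B \<in> bounded_ops \<Longrightarrow> (A o\<^sub>L B) \<in> bounded_ops"
  by (simp add: bounded_ops_def)

lemma rank_one_in_bounded_ops: "rank_one v \<in> bounded_ops"
  by (simp add: bounded_ops_def rank_one.rep_eq cinner_scaleC_left scaleC_scaleC)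

lemma oproj_in_bounded_ops: "oproj S e \<in> bounded_ops"
  unfolding oproj_def
  by (intro complex_vector.subspace_sum csubspace_bounded_ops rank_one_in_bounded_ops)

text \<open>The operator type contains all real-linear maps, so norm limits must be shown to stay
  complex-linear. Each linearity condition is an equation between continuous functions of
  \<open>A\<close>.\<close>

lemma closed_bounded_ops: "closed (bounded_ops :: ('a::chilbert_space \<Rightarrow>\<^sub>L 'a) set)"
proof -
  have "closed {A :: 'a \<Rightarrow>\<^sub>L 'a. A (c *\<^sub>C x) = c *\<^sub>C A x}" for c and x :: 'a
    by (intro closed_Collect_eq bounded_linear.continuous_on[OF bounded_linear_scaleC] continuous_intros)
  then show ?thesis
    unfolding bounded_ops_def by (intro closed_Collect_all)
qed

lemma compact_opsI:
  assumes "A \<in> bounded_ops" "compact C" "blinfun_apply A ` cball 0 1 \<subseteq> C"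
  shows "A \<in> compact_ops"
proof -
  have "closure (blinfun_apply A ` cball 0 1) \<subseteq> C"
    using assms by (simp add: closure_minimal compact_imp_closed)
  then have "compact (closure (blinfun_apply A ` cball 0 1))"
    using compact_Int_closed[OF assms(2) closed_closure] by (metis Int_absorb1)
  then show ?thesis
    using assms(1) by (simp add: compact_ops_def)
qed

lemma compact_ops_image_subset:
  assumes "A \<in> compact_ops"
  obtains C where "compact C" "\<And>x. norm x \<le> 1 \<Longrightarrow> A x \<in> C"
proof
  show "compact (closure (blinfun_apply A ` cball 0 1))"
    using assms by (simp add: compact_ops_def)
  show "A x \<in> closure (blinfun_apply A ` cball 0 1)" if "norm x \<le> 1" for x
    using that closure_subset by fastforce
qed

lemma compact_ops_bounded_ops: "A \<in> compact_ops \<Longrightarrow> A \<in> bounded_ops"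
  by (simp add: compact_ops_def)

lemma compact_ops_comp_right:
  assumes "A \<in> compact_ops" "B \<in> bounded_ops"
  shows "(A o\<^sub>L B) \<in> compact_ops"
proof -
  obtain C where C: "compact C" "\<And>x. norm x \<le> 1 \<Longrightarrow> A x \<in> C"
    using compact_ops_image_subset[OF assms(1)] by blast
  \<comment> \<open>Dividing by \<open>b\<close> brings \<open>B x\<close> back into the unit ball;
    the added 1 keeps \<open>b\<close> positive when \<open>B\<close> is 0.\<close>
  define b where "b = norm B + 1"
  have b: "b > 0"
    by (simp add: b_def add_nonneg_pos)
  show ?thesis
  proof (rule compact_opsI)
    show "compact ((\<lambda>y. b *\<^sub>R y) ` C)"
      using C(1) by (rule compact_scaling)
    show "blinfun_apply (A o\<^sub>L B) ` cball 0 1 \<subseteq> (\<lambda>y. b *\<^sub>R y) ` C"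
    proof clarsimp
      fix x :: 'a assume x: "norm x \<le> 1"
      have "norm (B x) \<le> norm B * 1"
        by (rule order_trans[OF norm_blinfun mult_left_mono[OF x norm_ge_zero]])
      then have "norm (B x /\<^sub>R b) \<le> 1"
        using b by (simp add: b_def field_simps)
      then have "A (B x /\<^sub>R b) \<in> C"
        by (rule C(2))
      moreover have "A (B x) = b *\<^sub>R A (B x /\<^sub>R b)"
        using b by (simp add: blinfun.scaleR_right)
      ultimately show "A (B x) \<in> (\<lambda>y. b *\<^sub>R y) ` C"
        by blast
    qed
  qed (use assms in \<open>auto intro: compose_in_bounded_ops compact_ops_bounded_ops\<close>)
qed

lemma compact_ops_comp_left:
  assumes "A \<in> compact_ops" "B \<in> bounded_ops"
  shows "(B o\<^sub>L A) \<in> compact_ops"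
proof -
  obtain C where C: "compact C" "\<And>x. norm x \<le> 1 \<Longrightarrow> A x \<in> C"
    using compact_ops_image_subset[OF assms(1)] by blast
  have "compact (blinfun_apply B ` C)"
    using C(1) by (intro compact_continuous_image continuous_intros)
  then show ?thesis
    by (rule compact_opsI[rotated])
      (use assms C(2) in \<open>auto intro: compose_in_bounded_ops compact_ops_bounded_ops\<close>)
qed

lemma compact_ops_add:
  assumes "A \<in> compact_ops" "B \<in> compact_ops"
  shows "A + B \<in> compact_ops"
proof -
  obtain C where C: "compact C" "\<And>x. norm x \<le> 1 \<Longrightarrow> A x \<in> C"
    using compact_ops_image_subset[OF assms(1)] by blast
  obtain D where D: "compact D" "\<And>x. norm x \<le> 1 \<Longrightarrow> B x \<in> D"
    using compact_ops_image_subset[OF assms(2)] by blast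
  have "A + B \<in> bounded_ops"
    using assms csubspace_bounded_ops compact_ops_bounded_ops
    by (auto intro: complex_vector.subspace_add)
  moreover have "compact {x + y | x y. x \<in> C \<and> y \<in> D}"
    using compact_sums[OF C(1) D(1)] .
  ultimately show ?thesis
  proof (rule compact_opsI)
    show "blinfun_apply (A + B) ` cball 0 1 \<subseteq> {x + y | x y. x \<in> C \<and> y \<in> D}"
      using C(2) D(2) by (force simp: blinfun.add_left)
  qed
qed

lemma compact_ops_zero: "0 \<in> compact_ops"
  by (rule compact_opsI[of _ "{0}"]) (auto simp: csubspace_bounded_ops complex_vector.subspace_0)

lemma compact_ops_sum: "(\<And>i. i \<in> S \<Longrightarrow> f i \<in> compact_ops) \<Longrightarrow> (\<Sum>i\<in>S. f i) \<in> compact_ops"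
  by (induction S rule: infinite_finite_induct) (auto intro: compact_ops_add compact_ops_zero)

lemma rank_one_in_compact_ops: "rank_one v \<in> compact_ops"
proof (rule compact_opsI)
  have "continuous_on (cball 0 (norm v)) (\<lambda>c. c *\<^sub>C v)"
    by (rule bounded_linear.continuous_on[OF _ continuous_on_id],
        rule bounded_linear_intro[where K = "norm v"])
      (simp_all add: scaleC_add_left scaleR_scaleC scaleC_scaleC norm_scaleC scaleR_conv_of_real)
  then show "compact ((\<lambda>c. c *\<^sub>C v) ` cball 0 (norm v))"
    by (intro compact_continuous_image) simp_all
  have "cmod (cinner x v) \<le> norm v" if "norm x \<le> 1" for x
    using cinner_Cauchy_Schwarz[of x v] mult_right_mono[OF that, of "norm v"] by simp
  then show "blinfun_apply (rank_one v) ` cball 0 1 \<subseteq> (\<lambda>c. c *\<^sub>C v) ` cball 0 (norm v)"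
    by (auto simp: rank_one.rep_eq)
qed (rule rank_one_in_bounded_ops)

lemma oproj_in_compact_ops: "oproj S e \<in> compact_ops"
  unfolding oproj_def by (intro compact_ops_sum rank_one_in_compact_ops)

text \<open>Scaling is composition with a multiple of the identity, hence a case of the ideal
  property.\<close>

lemma compact_ops_scaleR:
  assumes "A \<in> compact_ops"
  shows "c *\<^sub>R A \<in> compact_ops"
proof -
  have "c *\<^sub>R id_blinfun \<in> bounded_ops"
    by (simp add: bounded_ops_def scaleR_scaleC scaleC_blinfun.rep_eq scaleC_scaleC mult.commute)
  then have "((c *\<^sub>R id_blinfun) o\<^sub>L A) \<in> compact_ops"
    by (rule compact_ops_comp_left[OF assms])
  moreover have "((c *\<^sub>R id_blinfun) o\<^sub>L A) = c *\<^sub>R A"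
    by (rule blinfun_eqI) (simp add: blinfun.scaleR_left)
  ultimately show ?thesis
    by simp
qed

text \<open>Total boundedness survives norm limits: a finite net for the image of the unit ball
  under a nearby compact operator is, with a larger radius, a net for the image under
  \<open>A\<close>.\<close>

lemma closed_compact_ops: "closed (compact_ops :: ('a::chilbert_space \<Rightarrow>\<^sub>L 'a) set)"
proof -
  have "A \<in> compact_ops" if A: "A \<in> closure compact_ops" for A :: "'a \<Rightarrow>\<^sub>L 'a"
  proof -
    have bA: "A \<in> bounded_ops"
      using A closure_minimal[OF _ closed_bounded_ops, of compact_ops] compact_ops_bounded_ops
      by blast
    let ?I = "blinfun_apply A ` cball 0 1"
    have "\<exists>K. finite K \<and> closure ?I \<subseteq> (\<Union>x\<in>K. ball x \<epsilon>)" if "\<epsilon> > 0" for \<epsilon> :: real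
    proof -
      have "\<epsilon> / 4 > 0"
        using that by simp
      then obtain B where B: "B \<in> compact_ops" "dist B A < \<epsilon> / 4"
        using A unfolding closure_approachable by blast
      obtain C where C: "compact C" "\<And>x. norm x \<le> 1 \<Longrightarrow> B x \<in> C"
        using compact_ops_image_subset[OF B(1)] by blast
      obtain K where K: "finite K" "C \<subseteq> (\<Union>x\<in>K. ball x (\<epsilon> / 4))"
        using C(1) \<open>\<epsilon> / 4 > 0\<close> unfolding compact_eq_totally_bounded by blast
      \<comment> \<open>A finite union of closed balls is closed, so it also contains the closure of
        the image; the radius leaves room to return to open balls.\<close>
      have "?I \<subseteq> (\<Union>x\<in>K. cball x (\<epsilon> / 2))"
      proof (rule image_subsetI)
        fix x :: 'a assume "x \<in> cball 0 1"
        then have x: "norm x \<le> 1"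
          by simp
        obtain y where y: "y \<in> K" "dist y (B x) < \<epsilon> / 4"
          using C(2)[OF x] K(2) by auto
        have "dist (B x) (A x) = norm ((B - A) x)"
          by (simp add: dist_norm blinfun.diff_left)
        also have "\<dots> \<le> norm (B - A) * 1"
          by (rule order_trans[OF norm_blinfun mult_left_mono[OF x norm_ge_zero]])
        finally have "dist (B x) (A x) \<le> \<epsilon> / 4"
          using B(2) by (simp add: dist_norm)
        then have "dist y (A x) \<le> \<epsilon> / 2"
          using y(2) dist_triangle[of y "A x" "B x"] by simp
        then show "A x \<in> (\<Union>x\<in>K. cball x (\<epsilon> / 2))"
          using y(1) by auto
      qed
      moreover have "closed (\<Union>x\<in>K. cball x (\<epsilon> / 2))"
        using K(1) by (intro closed_UN) auto
      ultimately have "closure ?I \<subseteq> (\<Union>x\<in>K. cball x (\<epsilon> / 2))"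
        by (rule closure_minimal)
      also have "\<dots> \<subseteq> (\<Union>x\<in>K. ball x \<epsilon>)"
        by (intro UN_mono subset_refl) (use that in auto)
      finally show ?thesis
        using K(1) by blast
    qed
    then have "compact (closure ?I)"
      by (simp add: compact_eq_totally_bounded complete_eq_closed)
    then show ?thesis
      using bA by (simp add: compact_ops_def)
  qed
  then show ?thesis
    unfolding closure_subset_eq[symmetric] by blast
qed

section \<open>Singular vectors of a compact operator\<close>

lemma compact_ops_convergent_subseq:
  fixes a :: "nat \<Rightarrow> 'a::chilbert_space"
  assumes "T \<in> compact_ops" "\<And>n. norm (a n) \<le> 1"
  obtains r y where "strict_mono r" "(\<lambda>n. T (a (r n))) \<longlonglongrightarrow> y"
proof -
  obtain C where C: "compact C" "\<And>x. norm x \<le> 1 \<Longrightarrow> T x \<in> C"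
    using compact_ops_image_subset[OF assms(1)] by blast
  have "\<forall>n. T (a n) \<in> C"
    using C(2) assms(2) by blast
  then have "\<exists>y\<in>C. \<exists>r. strict_mono r \<and> ((\<lambda>n. T (a n)) \<circ> r) \<longlonglongrightarrow> y"
    using C(1)[unfolded compact_def, rule_format, of "\<lambda>n. T (a n)"] by simp
  then show thesis
    using that by (auto simp: comp_def)
qed

text \<open>This supplies the next singular vector. A maximising sequence has convergent images
  along a subsequence, and that subsequence itself turns out to converge in norm, so weak
  compactness is avoided.\<close>

lemma compact_ops_attains_norm:
  assumes T: "T \<in> compact_ops" and M: "closed M" "csubspace M" and x0: "x0 \<in> M" "T x0 \<noteq> 0"
  obtains v where "v \<in> M" "norm v = 1" "T v \<noteq> 0" "\<And>x. x \<in> M \<Longrightarrow> norm (T x) \<le> norm (T v) * norm x"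
proof -
  let ?W = "(\<lambda>x. norm (T x)) ` (M \<inter> cball 0 1)"
  define m where "m = Sup ?W"
  have M_scaleR: "r *\<^sub>R x \<in> M" if "x \<in> M" for r x
    unfolding scaleR_scaleC using M(2) that by (rule complex_vector.subspace_scale)
  have "norm (T x) \<le> norm T" if "norm x \<le> 1" for x
    using order_trans[OF norm_blinfun mult_left_mono[OF that norm_ge_zero]] by simp
  then have bdd: "bdd_above ?W"
    by (intro bdd_aboveI[of _ "norm T"]) auto
  have "0 \<in> M"
    using M(2) by (rule complex_vector.subspace_0)
  then have ne: "?W \<noteq> {}"
    by auto
  have le_m: "norm (T x) \<le> m * norm x" if x: "x \<in> M" for x
  proof (cases "x = 0")
    case False
    have "norm (T (inverse (norm x) *\<^sub>R x)) \<le> m"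
      unfolding m_def using False M_scaleR[OF x] by (intro cSup_upper[OF _ bdd] imageI) auto
    then show ?thesis
      using False by (simp add: blinfun.scaleR_right field_simps)
  qed simp
  have "x0 \<noteq> 0"
    using x0(2) by auto
  have m: "m > 0"
  proof (rule ccontr)
    assume "\<not> m > 0"
    then have "m * norm x0 \<le> 0"
      by (simp add: mult_nonpos_nonneg)
    then show False
      using le_m[OF x0(1)] x0(2) by (metis norm_le_zero_iff order_trans)
  qed
  have "\<exists>x. x \<in> M \<and> norm x \<le> 1 \<and> m - inverse (real (Suc n)) < norm (T x)" for n
  proof -
    have "m - inverse (real (Suc n)) < Sup ?W"
      by (simp add: m_def)
    then show ?thesis
      unfolding less_cSup_iff[OF ne bdd] by auto
  qed
  then obtain a where a: "\<And>n. a n \<in> M" "\<And>n. norm (a n) \<le> 1"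
    "\<And>n. m - inverse (real (Suc n)) < norm (T (a n))"
    by metis
  obtain r y where r: "strict_mono r" and lim: "(\<lambda>n. T (a (r n))) \<longlonglongrightarrow> y"
    by (rule compact_ops_convergent_subseq[OF T a(2)])
  have norm_le: "norm (T (a n)) \<le> m" for n
    using order_trans[OF le_m[OF a(1)] mult_left_mono[OF a(2)]] m by simp
  have "(\<lambda>n. norm (T (a n))) \<longlonglongrightarrow> m"
  proof (rule tendsto_sandwich)
    show "(\<lambda>n. m - inverse (real (Suc n))) \<longlonglongrightarrow> m"
      using tendsto_diff[OF tendsto_const LIMSEQ_inverse_real_of_nat] by simp
    show "\<forall>\<^sub>F n in sequentially. m - inverse (real (Suc n)) \<le> norm (T (a n))"
      using a(3) by (simp add: less_imp_le)
  qed (use norm_le in auto)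
  then have "(\<lambda>n. norm (T (a (r n)))) \<longlonglongrightarrow> m"
    using LIMSEQ_subseq_LIMSEQ[OF _ r, of "\<lambda>n. norm (T (a n))" m] by (simp add: comp_def)
  then have norm_y: "norm y = m"
    using tendsto_norm[OF lim] LIMSEQ_unique by blast
  \<comment> \<open>The norm of \<open>T (a (r i) + a (r k))\<close> is nearly \<open>2 * m\<close>, so \<open>a (r i) + a (r k)\<close> has norm
    nearly 2, and the parallelogram law makes the difference small.\<close>
  have "Cauchy (\<lambda>n. a (r n))"
  proof (rule metric_CauchyI)
    fix \<epsilon> :: real assume \<epsilon>: "\<epsilon> > 0"
    \<comment> \<open>The parallelogram law will give the bound \<open>8 * t\<close> for the squared
      distance, which this choice puts below the square of \<open>\<epsilon>\<close>.\<close>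
    define t where "t = \<epsilon>\<^sup>2 / 16"
    have t: "t > 0"
      using \<epsilon> by (simp add: t_def)
    then obtain N where N: "\<And>n. n \<ge> N \<Longrightarrow> dist (T (a (r n))) y < m * t"
      using lim m unfolding lim_sequentially by (meson mult_pos_pos)
    have "dist (a (r i)) (a (r k)) < \<epsilon>" if "i \<ge> N" "k \<ge> N" for i k
    proof -
      let ?u = "a (r i)" and ?w = "a (r k)"
      have "2 *\<^sub>R y = T ?u + T ?w - ((T ?u - y) + (T ?w - y))"
        by (simp add: scaleR_2)
      then have "norm (2 *\<^sub>R y) \<le> norm (T ?u + T ?w) + norm ((T ?u - y) + (T ?w - y))"
        by (metis norm_triangle_ineq4)
      then have "2 * m \<le> norm (T ?u + T ?w) + (norm (T ?u - y) + norm (T ?w - y))"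
        using norm_y norm_triangle_ineq[of "T ?u - y" "T ?w - y"] by simp
      then have "2 * m - 2 * (m * t) \<le> norm (T ?u + T ?w)"
        using N[OF that(1)] N[OF that(2)] by (simp add: dist_norm)
      also have "\<dots> \<le> m * norm (?u + ?w)"
        using le_m[of "?u + ?w"] complex_vector.subspace_add[OF M(2) a(1) a(1)]
        by (simp add: blinfun.add_right)
      finally have "m * (2 - 2 * t) \<le> m * norm (?u + ?w)"
        by (simp add: algebra_simps)
      then have "2 - 2 * t \<le> norm (?u + ?w)"
        using m by simp
      \<comment> \<open>The tangent bound for the square at 2 keeps everything linear: the squared
        norm of the sum is at least \<open>4 - 8 * t\<close>.\<close>
      moreover have "(norm (?u + ?w))\<^sup>2 \<ge> 4 * norm (?u + ?w) - 4"
        using zero_le_power2[of "norm (?u + ?w) - 2"] by (simp add: power2_diff)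
      moreover have "(norm ?u)\<^sup>2 \<le> 1" "(norm ?w)\<^sup>2 \<le> 1"
        using a(2) by (simp_all add: power_le_one)
      ultimately have "(norm (?u - ?w))\<^sup>2 \<le> 8 * t"
        using parallelogram_law[of ?u ?w] by linarith
      also have "\<dots> < \<epsilon>\<^sup>2"
        using \<epsilon> by (simp add: t_def)
      finally show ?thesis
        using \<epsilon> by (simp add: dist_norm power_less_imp_less_base)
    qed
    then show "\<exists>N. \<forall>i\<ge>N. \<forall>k\<ge>N. dist (a (r i)) (a (r k)) < \<epsilon>"
      by blast
  qed
  then obtain v where v: "(\<lambda>n. a (r n)) \<longlonglongrightarrow> v"
    using Cauchy_convergent convergent_def by blast
  have "v \<in> M"
    using closed_sequentially[OF M(1) _ v] a(1) by simp
  have "norm v \<le> 1"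
    using tendsto_norm[OF v] a(2) by (auto intro: LIMSEQ_le_const2)
  have "(\<lambda>n. T (a (r n))) \<longlonglongrightarrow> T v"
    by (intro tendsto_intros v)
  then have Tv: "norm (T v) = m"
    using lim norm_y LIMSEQ_unique by blast
  then have "m * 1 \<le> m * norm v"
    using le_m[OF \<open>v \<in> M\<close>] by simp
  then have "norm v = 1"
    using m \<open>norm v \<le> 1\<close> by simp
  then show thesis
    using that[OF \<open>v \<in> M\<close>] Tv m le_m by auto
qed

text \<open>First variation at the maximiser: moving \<open>v\<close> towards \<open>x\<close> would
  raise the squared norm of the image to first order, but the squared norm of the argument only to
  second order.\<close>

lemma norm_maximiser_orthogonal:
  assumes T: "T \<in> bounded_ops" and M: "csubspace M" and v: "v \<in> M" "norm v = 1"
    and max: "\<And>x. x \<in> M \<Longrightarrow> norm (T x) \<le> norm (T v) * norm x"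
    and x: "x \<in> M" "cinner v x = 0"
  shows "cinner (T v) (T x) = 0"
proof (rule ccontr)
  define w where "w = cinner (T v) (T x)"
  define b where "b = (norm (T v))\<^sup>2 * (norm x)\<^sup>2"
  \<comment> \<open>The step size makes \<open>b * s\<close> smaller than 1, whereas maximality will
    force it to be at least 2.\<close>
  define s where "s = 1 / (b + 1)"
  \<comment> \<open>The factor \<open>w\<close> fixes the phase, so that
    \<open>cinner (T v) (T z)\<close> is real and positive.\<close>
  define z where "z = (complex_of_real s * w) *\<^sub>C x"
  assume "cinner (T v) (T x) \<noteq> 0"
  then have w: "(cmod w)\<^sup>2 > 0"
    by (simp add: w_def)
  have b: "b \<ge> 0"
    by (simp add: b_def)
  then have s: "s > 0"
    by (simp add: s_def)
  have "cinner (T v) (T z) = complex_of_real (s * (cmod w)\<^sup>2)"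
    using complex_norm_square[of w]
    by (simp add: z_def bounded_ops_scaleC[OF T] cinner_scaleC_right w_def[symmetric] mult.commute)
  then have "(norm (T (v + z)))\<^sup>2 = (norm (T v))\<^sup>2 + (norm (T z))\<^sup>2 + 2 * (s * (cmod w)\<^sup>2)"
    by (simp add: blinfun.add_right norm_add_cinner)
  moreover have "(norm (v + z))\<^sup>2 = 1 + s\<^sup>2 * (cmod w)\<^sup>2 * (norm x)\<^sup>2"
    using pythagoras[of v z] x(2) v(2)
    by (simp add: z_def cinner_scaleC_right norm_scaleC norm_mult power_mult_distrib)
  moreover have "norm (T (v + z)) \<le> norm (T v) * norm (v + z)"
    unfolding z_def
    by (intro max complex_vector.subspace_add[OF M v(1)] complex_vector.subspace_scale[OF M x(1)])
  then have "(norm (T (v + z)))\<^sup>2 \<le> (norm (T v))\<^sup>2 * (norm (v + z))\<^sup>2"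
    by (metis norm_ge_zero power_mono power_mult_distrib)
  ultimately have "(norm (T z))\<^sup>2 + 2 * (s * (cmod w)\<^sup>2) \<le> (norm (T v))\<^sup>2 * (s\<^sup>2 * (cmod w)\<^sup>2 * (norm x)\<^sup>2)"
    by (simp add: distrib_left)
  then have "2 * (s * (cmod w)\<^sup>2) \<le> (norm (T v))\<^sup>2 * (s\<^sup>2 * (cmod w)\<^sup>2 * (norm x)\<^sup>2)"
    using zero_le_power2[of "norm (T z)"] by linarith
  also have "\<dots> = (s * (cmod w)\<^sup>2) * (b * s)"
    by (simp add: b_def power2_eq_square)
  finally have "2 \<le> b * s"
    using s w by (simp add: mult.commute[of 2])
  then show False
    using b by (simp add: s_def field_simps)
qed

text \<open>The orthogonal complement of the first \<open>n\<close> vectors. It depends only on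
  these, which permits choosing the sequence recursively.\<close>

definition annihilator :: "nat \<Rightarrow> (nat \<Rightarrow> 'a::complex_inner) \<Rightarrow> 'a set"
  where "annihilator n e = {x. \<forall>k<n. cinner x (e k) = 0}"

lemma csubspace_annihilator: "csubspace (annihilator n e)"
  by (simp add: complex_vector.subspace_def annihilator_def cinner_add_left cinner_scaleC_left)

lemma bounded_linear_cinner_left: "bounded_linear (\<lambda>x::'a::complex_inner. cinner x y)"
  by (rule bounded_linear_intro[where K = "norm y"])
    (simp_all add: cinner_add_left scaleR_scaleC cinner_scaleC_left scaleR_conv_of_real
      cinner_Cauchy_Schwarz)

lemma closed_annihilator: "closed (annihilator n e)"
  unfolding annihilator_def
  by (intro closed_Collect_all closed_Collect_imp closed_Collect_eq
      bounded_linear.continuous_on[OF bounded_linear_cinner_left] continuous_intros) simp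

lemma annihilator_mono: "m \<le> n \<Longrightarrow> annihilator n e \<subseteq> annihilator m e"
  by (auto simp: annihilator_def)

lemma oproj_diff_in_annihilator:
  "orthonormal_on {..<n} e \<Longrightarrow> x - oproj {..<n} e x \<in> annihilator n e"
  by (simp add: annihilator_def cinner_oproj_diff)

lemma orthonormal_onI:
  assumes "\<And>i. i \<in> S \<Longrightarrow> norm (e i) = 1"
    and "\<And>i j. i \<in> S \<Longrightarrow> j \<in> S \<Longrightarrow> j < i \<Longrightarrow> cinner (e i) (e j) = 0"
  shows "orthonormal_on S e"
  unfolding orthonormal_on_def
proof (intro ballI)
  fix i j assume "i \<in> S" "j \<in> S"
  then show "cinner (e i) (e j) = (if i = j then 1 else 0)"
    using assms(1)[of i] assms(2)[of i j] assms(2)[of j i] cinner_eq_0_commute[of "e i" "e j"]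
    by (cases i j rule: linorder_cases) (simp_all add: cinner_self)
qed

text \<open>Greedy construction: each new vector maximises \<open>T\<close> on the orthogonal
  complement of the earlier ones. It can stop only if \<open>T\<close> vanishes on such a
  complement, which is the first case.\<close>

lemma singular_vectors_exist:
  fixes T :: "'a::chilbert_space \<Rightarrow>\<^sub>L 'a"
  assumes T: "T \<in> compact_ops"
  obtains (finite_rank) n e where "orthonormal_on {..<n::nat} e" "T = (T o\<^sub>L oproj {..<n} e)"
  | (infinite_rank) e where "orthonormal_on UNIV e" "\<And>n. T (e n) \<noteq> 0"
      "\<And>i j. i \<noteq> j \<Longrightarrow> cinner (T (e i)) (T (e j)) = 0"
      "(\<lambda>n. T - (T o\<^sub>L oproj {..<n} e)) \<longlonglongrightarrow> 0"
proof (cases "\<exists>n e. orthonormal_on {..<n::nat} e \<and> T = (T o\<^sub>L oproj {..<n} e)")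
  case True
  then show thesis
    using finite_rank by blast
next
  case False
  \<comment> \<open>\<open>good e n v\<close> says that \<open>v\<close> may serve as the vector of
    index \<open>n\<close> after \<open>e 0\<close>, ..., \<open>e (n - 1)\<close>.\<close>
  define good where "good e n v \<longleftrightarrow> v \<in> annihilator n e \<and> norm v = 1 \<and> T v \<noteq> 0 \<and>
    (\<forall>x\<in>annihilator n e. norm (T x) \<le> norm (T v) * norm x)" for e n v
  have step: "\<exists>v. good e n v" if "\<And>k. k < n \<Longrightarrow> good e k (e k)" for n e
  proof -
    have orth: "orthonormal_on {..<n} e"
      by (rule orthonormal_onI) (use that in \<open>auto simp: good_def annihilator_def\<close>)
    then have "T \<noteq> (T o\<^sub>L oproj {..<n} e)"
      using False by blast
    then obtain x where "T x \<noteq> T (oproj {..<n} e x)"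
      by (metis blinfun_eqI blinfun_apply_blinfun_compose)
    then have "T (x - oproj {..<n} e x) \<noteq> 0"
      by (simp add: blinfun.diff_right)
    then show ?thesis
      unfolding good_def
      by (metis compact_ops_attains_norm[OF T closed_annihilator csubspace_annihilator
            oproj_diff_in_annihilator[OF orth]])
  qed
  \<comment> \<open>Each choice depends on all earlier vectors, not just the last, hence choice
    along a well-founded relation.\<close>
  have "\<exists>e. \<forall>n. good e n (e n)"
  proof (rule dependent_wf_choice[OF wf_less_than])
    fix f g :: "nat \<Rightarrow> 'a" and n r
    assume "\<And>k. (k, n) \<in> less_than \<Longrightarrow> f k = g k"
    then have "annihilator n f = annihilator n g"
      by (simp add: annihilator_def)
    then show "good f n r = good g n r"
      by (simp add: good_def)
  qed (use step in auto)
  then obtain e where e: "\<And>n. good e n (e n)"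
    by blast
  have ann: "e j \<in> annihilator i e" if "i \<le> j" for i j
    using e[of j] annihilator_mono[OF that] by (auto simp: good_def)
  have norm_e: "norm (e i) = 1" for i
    using e by (simp add: good_def)
  have T_le: "norm (T x) \<le> norm (T (e i)) * norm x" if "x \<in> annihilator i e" for i x
    using e that by (simp add: good_def)
  have orth: "orthonormal_on UNIV e"
    by (rule orthonormal_onI) (use e in \<open>auto simp: good_def annihilator_def\<close>)
  have less: "cinner (T (e i)) (T (e j)) = 0" if "i < j" for i j
  proof (rule norm_maximiser_orthogonal[OF compact_ops_bounded_ops[OF T] csubspace_annihilator])
    show "e i \<in> annihilator i e" "e j \<in> annihilator i e"
      using ann that by simp_all
    show "cinner (e i) (e j) = 0"
      using orth that by (simp add: orthonormal_on_def)
  qed (simp_all add: norm_e T_le)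
  have T_orth: "cinner (T (e i)) (T (e j)) = 0" if "i \<noteq> j" for i j
    using less[of i j] less[of j i] cinner_eq_0_commute that by (metis linorder_neqE_nat)
  define s where "s n = norm (T (e n))" for n
  have "decseq s"
    unfolding s_def using T_le[OF ann] norm_e by (intro decseq_SucI) (metis le_SucI le_refl mult.right_neutral)
  then obtain l where l: "s \<longlonglongrightarrow> l" "\<And>n. l \<le> s n"
    using decseq_convergent[of s 0] by (auto simp: s_def)
  \<comment> \<open>Otherwise the pairwise orthogonal images, all of norm at least \<open>l\<close>,
    would stay at distance at least \<open>l\<close> from each other and have no convergent
    subsequence.\<close>
  have "l = 0"
  proof (rule ccontr)
    assume "l \<noteq> 0"
    moreover have "l \<ge> 0"
      using l(1) by (rule LIMSEQ_le_const) (simp add: s_def)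
    ultimately have lpos: "l > 0"
      by simp
    obtain r y where r: "strict_mono r" and lim: "(\<lambda>n. T (e (r n))) \<longlonglongrightarrow> y"
      by (rule compact_ops_convergent_subseq[OF T, of e]) (simp add: norm_e)
    obtain N where N: "\<And>i k. i \<ge> N \<Longrightarrow> k \<ge> N \<Longrightarrow> norm (T (e (r i)) - T (e (r k))) < l"
      using CauchyD[OF LIMSEQ_imp_Cauchy[OF lim] lpos] by auto
    have "r N \<noteq> r (Suc N)"
      using strict_monoD[OF r lessI] by (metis less_irrefl)
    then have "cinner (T (e (r N))) (- T (e (r (Suc N)))) = 0"
      using T_orth cinner_scaleC_right[of "T (e (r N))" "- 1" "T (e (r (Suc N)))"]
      by (simp add: complex_vector.scale_minus_left scaleC_one)
    from pythagoras[OF this]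
    have "(s (r N))\<^sup>2 \<le> (norm (T (e (r N)) - T (e (r (Suc N)))))\<^sup>2"
      by (simp add: s_def)
    then have "s (r N) \<le> norm (T (e (r N)) - T (e (r (Suc N))))"
      by (rule power2_le_imp_le) simp
    then show False
      using N[of N "Suc N"] l(2)[of "r N"] by simp
  qed
  \<comment> \<open>The remainder \<open>x - oproj {..<n} e x\<close> lies in the complement on
    which \<open>e n\<close> maximises \<open>T\<close>.\<close>
  have "norm (T - (T o\<^sub>L oproj {..<n} e)) \<le> s n" for n
  proof (rule norm_blinfun_bound)
    fix x
    have orth_n: "orthonormal_on {..<n} e"
      using orth by (rule orthonormal_on_subset) simp
    have "norm ((T - (T o\<^sub>L oproj {..<n} e)) x) = norm (T (x - oproj {..<n} e x))"
      by (simp add: blinfun.diff_left blinfun.diff_right)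
    also have "\<dots> \<le> s n * norm (x - oproj {..<n} e x)"
      unfolding s_def by (intro T_le oproj_diff_in_annihilator orth_n)
    also have "\<dots> \<le> s n * norm x"
      by (intro mult_left_mono norm_oproj_diff_le orth_n) (simp_all add: s_def)
    finally show "norm ((T - (T o\<^sub>L oproj {..<n} e)) x) \<le> s n * norm x" .
  qed (simp add: s_def)
  then have lim: "(\<lambda>n. T - (T o\<^sub>L oproj {..<n} e)) \<longlonglongrightarrow> 0"
    using l(1) unfolding \<open>l = 0\<close> by (rule Lim_null_comparison[OF always_eventually[OF allI]])
  have "T (e n) \<noteq> 0" for n
    using e by (simp add: good_def)
  then show thesis
    by (rule infinite_rank[OF orth _ T_orth lim])
qed

section \<open>Moving a compact factor to the other side\<close>

lemma oproj_basis:
  assumes "finite S" "orthonormal_on UNIV e"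
  shows "oproj S e (e i) = (if i \<in> S then e i else 0)"
proof -
  have "oproj S e (e i) = (\<Sum>k\<in>S. if k = i then e k else 0)"
    unfolding oproj_apply
    by (intro sum.cong refl) (use assms(2) in \<open>auto simp: orthonormal_on_def scaleC_one\<close>)
  then show ?thesis
    using assms(1) by simp
qed

lemma norm_oproj_blinfun_le_1:
  "finite S \<Longrightarrow> orthonormal_on S e \<Longrightarrow> norm (oproj S e) \<le> 1"
  by (rule norm_blinfun_bound) (simp_all add: norm_oproj_le)

lemma compact_ops_approx_oproj:
  assumes A: "A \<in> compact_ops" and "\<epsilon> > 0"
  obtains n g where "orthonormal_on {..<n::nat} g" "norm (A - (A o\<^sub>L oproj {..<n} g)) < \<epsilon>"
proof (rule singular_vectors_exist[OF A])
  fix n and g :: "nat \<Rightarrow> 'a"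
  assume "orthonormal_on {..<n} g" "A = (A o\<^sub>L oproj {..<n} g)"
  then show thesis
    using that[of n g] \<open>\<epsilon> > 0\<close> by simp
next
  fix g :: "nat \<Rightarrow> 'a"
  assume g: "orthonormal_on UNIV g" and lim: "(\<lambda>n. A - (A o\<^sub>L oproj {..<n} g)) \<longlonglongrightarrow> 0"
  obtain n where "norm (A - (A o\<^sub>L oproj {..<n} g)) < \<epsilon>"
    using LIMSEQ_D[OF lim \<open>\<epsilon> > 0\<close>] by auto
  then show thesis
    using that[of n g] orthonormal_on_subset[OF g] by simp
qed

lemma summable_bessel:
  assumes "orthonormal_on UNIV f"
  shows "summable (\<lambda>k. (cmod (cinner x (f k)))\<^sup>2)"
proof (rule summableI_nonneg_bounded)
  show "(\<Sum>k<n. (cmod (cinner x (f k)))\<^sup>2) \<le> (norm x)\<^sup>2" for n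
    by (rule bessel_inequality) (use orthonormal_on_subset[OF assms] in auto)
qed simp

text \<open>Up to a small error \<open>A\<close> sees only finitely many vectors \<open>g i\<close>,
  and by Bessel the tail projections along \<open>f\<close> are uniformly small on these.\<close>

lemma compact_ops_oproj_tail:
  assumes A: "A \<in> compact_ops" and f: "orthonormal_on UNIV f" and "\<epsilon> > 0"
  shows "\<exists>N. \<forall>a\<ge>N. \<forall>b. norm (A o\<^sub>L oproj {a..<b} f) \<le> \<epsilon>"
proof -
  obtain n g where g: "orthonormal_on {..<n::nat} g"
    and G: "norm (A - (A o\<^sub>L oproj {..<n} g)) < \<epsilon> / 2"
    using compact_ops_approx_oproj[OF A, of "\<epsilon> / 2"] \<open>\<epsilon> > 0\<close> by auto
  \<comment> \<open>Chosen so that \<open>n\<close> coefficients of size \<open>\<delta>\<close>,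
    multiplied by the norm of \<open>A\<close>, cost at most half of \<open>\<epsilon>\<close>; the
    added 1 excludes a zero denominator.\<close>
  define \<delta> where "\<delta> = \<epsilon> / (2 * (norm A * real n + 1))"
  have pos: "norm A * real n + 1 > 0"
    by (simp add: add_nonneg_pos)
  then have \<delta>: "\<delta> > 0"
    using \<open>\<epsilon> > 0\<close> by (simp add: \<delta>_def)
  have "\<forall>\<^sub>F a in sequentially. \<forall>b. norm (oproj {a..<b} f x) \<le> \<delta>" for x
  proof -
    have "\<delta>\<^sup>2 > 0"
      using \<delta> by simp
    then obtain N where N: "\<And>a b. a \<ge> N \<Longrightarrow> norm (\<Sum>k\<in>{a..<b}. (cmod (cinner x (f k)))\<^sup>2) < \<delta>\<^sup>2"
      using summable_bessel[OF f, of x] unfolding summable_Cauchy by meson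
    have "norm (oproj {a..<b} f x) \<le> \<delta>" if "a \<ge> N" for a b
    proof (rule power2_le_imp_le)
      have "(norm (oproj {a..<b} f x))\<^sup>2 = (\<Sum>k\<in>{a..<b}. (cmod (cinner x (f k)))\<^sup>2)"
        by (rule norm_oproj) (use orthonormal_on_subset[OF f] in auto)
      then show "(norm (oproj {a..<b} f x))\<^sup>2 \<le> \<delta>\<^sup>2"
        using N[OF that, of b] by simp
    qed (use \<delta> in simp)
    then show ?thesis
      unfolding eventually_sequentially by blast
  qed
  then have "\<forall>\<^sub>F a in sequentially. \<forall>i\<in>{..<n}. \<forall>b. norm (oproj {a..<b} f (g i)) \<le> \<delta>"
    by (intro eventually_ball_finite) auto
  then obtain N where N: "\<And>a i b. a \<ge> N \<Longrightarrow> i < n \<Longrightarrow> norm (oproj {a..<b} f (g i)) \<le> \<delta>"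
    unfolding eventually_sequentially by auto
  have "norm (A o\<^sub>L oproj {a..<b} f) \<le> \<epsilon>" if "a \<ge> N" for a b
  proof (rule norm_blinfun_bound)
    fix x
    let ?y = "oproj {a..<b} f x"
    have "norm (oproj {..<n} g ?y) \<le> (\<Sum>i<n. norm (cinner ?y (g i) *\<^sub>C g i))"
      unfolding oproj_apply[of "{..<n}"] by (rule norm_sum)
    also have "\<dots> \<le> (\<Sum>i<n. norm x * \<delta>)"
    proof (rule sum_mono)
      fix i assume i: "i \<in> {..<n}"
      have "cinner (g i) (g i) = 1"
        using g i by (simp add: orthonormal_on_def)
      then have "complex_of_real ((norm (g i))\<^sup>2) = complex_of_real 1"
        by (simp only: cinner_self of_real_1)
      then have "(norm (g i))\<^sup>2 = 1"
        by (simp only: of_real_eq_iff)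
      then have "norm (g i) = 1"
        by (metis norm_ge_zero one_power2 power2_eq_imp_eq zero_le_one)
      \<comment> \<open>Self-adjointness moves the tail projection from \<open>x\<close> onto the
        fixed vector \<open>g i\<close>, where it is known to be small.\<close>
      then have "norm (cinner ?y (g i) *\<^sub>C g i) = cmod (cinner x (oproj {a..<b} f (g i)))"
        by (simp add: norm_scaleC oproj_selfadjoint)
      also have "\<dots> \<le> norm x * norm (oproj {a..<b} f (g i))"
        by (rule cinner_Cauchy_Schwarz)
      also have "\<dots> \<le> norm x * \<delta>"
        using N[OF that] i by (intro mult_left_mono) auto
      finally show "norm (cinner ?y (g i) *\<^sub>C g i) \<le> norm x * \<delta>" .
    qed
    finally have Gy: "norm (oproj {..<n} g ?y) \<le> real n * (norm x * \<delta>)"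
      by simp
    have y: "norm ?y \<le> norm x"
      by (rule norm_oproj_le) (use orthonormal_on_subset[OF f] in auto)
    have "norm (A ?y) \<le> norm ((A - (A o\<^sub>L oproj {..<n} g)) ?y) + norm (A (oproj {..<n} g ?y))"
      using norm_triangle_ineq[of "(A - (A o\<^sub>L oproj {..<n} g)) ?y" "A (oproj {..<n} g ?y)"]
      by (simp add: blinfun.diff_left)
    also have "norm ((A - (A o\<^sub>L oproj {..<n} g)) ?y) \<le> \<epsilon> / 2 * norm x"
      by (rule order_trans[OF norm_blinfun mult_mono]) (use G y \<open>\<epsilon> > 0\<close> in simp_all)
    also have "norm (A (oproj {..<n} g ?y)) \<le> norm A * (real n * (norm x * \<delta>))"
      by (rule order_trans[OF norm_blinfun mult_left_mono[OF Gy norm_ge_zero]])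
    also have "norm A * (real n * (norm x * \<delta>)) = (norm A * real n) * \<delta> * norm x"
      by simp
    also have "(norm A * real n) * \<delta> * norm x \<le> \<epsilon> / 2 * norm x"
    proof (rule mult_right_mono)
      show "(norm A * real n) * \<delta> \<le> \<epsilon> / 2"
        using pos \<open>\<epsilon> > 0\<close> by (simp add: \<delta>_def field_simps)
    qed simp
    finally show "norm ((A o\<^sub>L oproj {a..<b} f) x) \<le> \<epsilon> * norm x"
      by simp
  qed (use \<open>\<epsilon> > 0\<close> in simp)
  then show ?thesis
    by blast
qed

text \<open>In this form \<open>Z o\<^sub>L T\<close> lies in the principal ideal of
  \<open>T\<close> and the compact factor stands on the right, as the ideal product
  requires.\<close>

lemma compact_comp_factorization:
  fixes A T :: "'a::chilbert_space \<Rightarrow>\<^sub>L 'a"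
  assumes A: "A \<in> compact_ops" and T: "T \<in> compact_ops"
  shows "\<exists>Z\<in>bounded_ops. \<exists>K\<in>compact_ops. (A o\<^sub>L T) = ((Z o\<^sub>L T) o\<^sub>L K)"
proof (rule singular_vectors_exist[OF T])
  fix n and e :: "nat \<Rightarrow> 'a"
  assume "T = (T o\<^sub>L oproj {..<n} e)"
  \<comment> \<open>Here \<open>A\<close> itself serves as \<open>Z\<close> and the finite-rank
    projection as \<open>K\<close>.\<close>
  then have "(A o\<^sub>L T) = ((A o\<^sub>L T) o\<^sub>L oproj {..<n} e)"
    by (metis blinfun_apply_blinfun_compose blinfun_eqI)
  then show ?thesis
    using compact_ops_bounded_ops[OF A] oproj_in_compact_ops by blast
next
  fix e :: "nat \<Rightarrow> 'a"
  assume e: "orthonormal_on UNIV e" and nz: "\<And>n. T (e n) \<noteq> 0"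
    and T_orth: "\<And>i j. i \<noteq> j \<Longrightarrow> cinner (T (e i)) (T (e j)) = 0"
    and T_lim: "(\<lambda>n. T - (T o\<^sub>L oproj {..<n} e)) \<longlonglongrightarrow> 0"
  define f where "f n = complex_of_real (inverse (norm (T (e n)))) *\<^sub>C T (e n)" for n
  have Te: "T (e n) = complex_of_real (norm (T (e n))) *\<^sub>C f n" for n
    using nz[of n] by (simp add: f_def scaleC_scaleC scaleC_one)
  have f: "orthonormal_on UNIV f"
    by (rule orthonormal_onI)
      (use nz T_orth in \<open>auto simp: f_def norm_scaleC norm_inverse cinner_scaleC_left cinner_scaleC_right\<close>)
  have "\<exists>N. \<forall>a\<ge>N. \<forall>b. norm (A o\<^sub>L oproj {a..<b} f) \<le> (1/4) ^ j" for j :: nat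
    by (rule compact_ops_oproj_tail[OF A f]) simp
  then obtain N where N: "\<And>j a b. a \<ge> N j \<Longrightarrow> norm (A o\<^sub>L oproj {a..<b} f) \<le> (1/4) ^ j"
    by metis
  \<comment> \<open>Block boundaries: starting at 0 and increasing strictly, the blocks exhaust all
    indices. The tail estimate of index \<open>j\<close> becomes available from block
    \<open>Suc j\<close> on.\<close>
  have "\<exists>n. \<forall>j. (j = 0 \<longrightarrow> n j = 0) \<and> (n j < n (Suc j) \<and> N j \<le> n (Suc j))"
  proof (rule dependent_nat_choice)
    show "\<exists>y. (Suc j = 0 \<longrightarrow> y = 0) \<and> x < y \<and> N j \<le> y" for x j
      by (rule exI[of _ "Suc (x + N j)"]) simp
  qed simp
  then obtain n where n0: "n 0 = 0" and n_Suc: "\<And>j. n j < n (Suc j)" "\<And>j. N j \<le> n (Suc j)"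
    by blast
  have mono: "strict_mono n"
    using n_Suc(1) by (simp add: strict_mono_Suc_iff)
  define B where "B j = {n j..<n (Suc j)}" for j
  have finB: "finite (B j)" for j
    by (simp add: B_def)
  have disj: "i \<notin> B l" if "i \<in> B j" "l \<noteq> j" for i j l
  proof -
    have "n (Suc j) \<le> n l \<or> n (Suc l) \<le> n j"
      using that(2) strict_mono_less_eq[OF mono] by (metis Suc_leI linorder_neqE_nat)
    then show ?thesis
      using that(1) by (auto simp: B_def)
  qed
  have oproj_blocks: "(\<Sum>j<m. oproj (B j) e) = oproj {..<n m} e" for m
  proof (induction m)
    case (Suc m)
    have "{..<n (Suc m)} = {..<n m} \<union> B m"
      using n_Suc(1)[of m] by (auto simp: B_def)
    moreover have "{..<n m} \<inter> B m = {}"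
      by (auto simp: B_def)
    ultimately show ?case
      using Suc finB by (simp add: oproj_def sum.union_disjoint)
  qed (simp add: n0 oproj_def)
  define z where "z j = (2::real) ^ j *\<^sub>R (A o\<^sub>L oproj (B j) f)" for j
  define k where "k j = (1/2::real) ^ j *\<^sub>R oproj (B j) e" for j
  define Z where "Z = suminf z"
  define K where "K = suminf k"
  \<comment> \<open>Block 0 carries no smallness estimate, so the series is compared from index 1
    on; there the decay \<open>4\<^sup>-\<^sup>j\<close> outweighs the factor
    \<open>2 ^ Suc j\<close>.\<close>
  have "summable (\<lambda>j. z (Suc j))"
  proof (rule summable_comparison_test')
    show "summable (\<lambda>j. 2 * (1/2::real) ^ j)"
      by (intro summable_mult summable_geometric) simp
    show "norm (z (Suc j)) \<le> 2 * (1/2) ^ j" for j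
    proof -
      have "norm (z (Suc j)) \<le> 2 ^ Suc j * (1/4) ^ j"
        unfolding z_def B_def norm_scaleR using N[OF n_Suc(2), of j] by (simp add: mult_left_mono)
      also have "(2::real) ^ Suc j * (1/4) ^ j = 2 * (2 * (1/4)) ^ j"
        by (simp only: power_Suc power_mult_distrib mult.assoc)
      finally show ?thesis
        by simp
    qed
  qed
  then have z: "z sums Z"
    unfolding Z_def by (simp add: summable_Suc_iff summable_sums)
  have "summable k"
  proof (rule summable_comparison_test')
    show "summable (\<lambda>j. (1/2::real) ^ j)"
      by (intro summable_geometric) simp
    show "norm (k j) \<le> (1/2) ^ j" for j
      using mult_left_mono[OF norm_oproj_blinfun_le_1[OF finB orthonormal_on_subset[OF e subset_UNIV]], of "(1/2) ^ j" j]
      by (simp add: k_def)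
  qed
  then have k: "k sums K"
    unfolding K_def by (rule summable_sums)
  have z_ops: "z j \<in> bounded_ops" for j
    unfolding z_def
    by (intro compact_ops_bounded_ops compact_ops_scaleR compact_ops_comp_right A oproj_in_bounded_ops)
  have Z_ops: "Z \<in> bounded_ops"
    using z unfolding sums_def
    by (rule closed_sequentially[OF closed_bounded_ops, rotated])
      (intro complex_vector.subspace_sum csubspace_bounded_ops z_ops)
  have K_ops: "K \<in> compact_ops"
    using k unfolding sums_def
    by (rule closed_sequentially[OF closed_compact_ops, rotated])
      (simp add: k_def compact_ops_sum compact_ops_scaleR oproj_in_compact_ops)
  \<comment> \<open>The blocks are disjoint, so only the summand of the block containing
    \<open>i\<close> acts on \<open>f i\<close>.\<close>
  have Zf: "Z (f i) = 2 ^ j *\<^sub>R A (f i)" if i: "i \<in> B j" for i j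
  proof -
    have "z l (f i) = (if l = j then 2 ^ j *\<^sub>R A (f i) else 0)" for l
      using disj[OF i] i by (auto simp: z_def blinfun.scaleR_left oproj_basis[OF finB f])
    then have "(\<lambda>l. z l (f i)) sums (2 ^ j *\<^sub>R A (f i))"
      using sums_single[of j "\<lambda>_. 2 ^ j *\<^sub>R A (f i)"] by simp
    then show ?thesis
      using sums_unique2 bounded_linear.sums[OF blinfun.bounded_linear_left z] by blast
  qed
  \<comment> \<open>The weights in \<open>Z\<close> and in \<open>K\<close> are reciprocal on each
    block and cancel.\<close>
  have ZTk: "Z (T (k j x)) = A (T (oproj (B j) e x))" for j x
  proof -
    have ZTe: "Z (T (e i)) = 2 ^ j *\<^sub>R A (T (e i))" if i: "i \<in> B j" for i
    proof -
      \<comment> \<open>Stated for every scalar, then applied to the singular value that relates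
        \<open>T (e i)\<close> to \<open>f i\<close>.\<close>
      have "Z (c *\<^sub>C f i) = 2 ^ j *\<^sub>R A (c *\<^sub>C f i)" for c
        using bounded_ops_scaleC[OF Z_ops] bounded_ops_scaleC[OF compact_ops_bounded_ops[OF A]] Zf[OF i]
        by (simp add: scaleR_scaleC scaleC_scaleC mult.commute)
      then show ?thesis
        by (metis Te)
    qed
    have "U (oproj (B j) e x) = (\<Sum>i\<in>B j. cinner x (e i) *\<^sub>C U (e i))" if "U \<in> bounded_ops" for U
      by (simp add: oproj_apply blinfun.sum_right bounded_ops_scaleC[OF that])
    note lin = this[OF compose_in_bounded_ops[OF _ compact_ops_bounded_ops[OF T]], simplified]
    have "Z (T (k j x)) = (1/2) ^ j *\<^sub>R Z (T (oproj (B j) e x))"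
      by (simp add: k_def blinfun.scaleR_left blinfun.scaleR_right)
    also have "\<dots> = (\<Sum>i\<in>B j. (1/2) ^ j *\<^sub>R (cinner x (e i) *\<^sub>C (2 ^ j *\<^sub>R A (T (e i)))))"
      by (simp add: lin[OF Z_ops] ZTe scaleR_sum_right)
    also have "\<dots> = (\<Sum>i\<in>B j. cinner x (e i) *\<^sub>C A (T (e i)))"
    proof (rule sum.cong)
      fix i
      have "complex_of_real ((1/2) ^ j) * complex_of_real (2 ^ j) = 1"
        by (simp flip: power_mult_distrib)
      then have "complex_of_real ((1/2) ^ j) * (cinner x (e i) * complex_of_real (2 ^ j)) = cinner x (e i)"
        by (simp only: mult.left_commute mult_1_right)
      then show "(1/2) ^ j *\<^sub>R (cinner x (e i) *\<^sub>C (2 ^ j *\<^sub>R A (T (e i)))) = cinner x (e i) *\<^sub>C A (T (e i))"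
        by (simp only: scaleR_scaleC scaleC_scaleC)
    qed simp
    also have "\<dots> = A (T (oproj (B j) e x))"
      by (rule lin[OF compact_ops_bounded_ops[OF A], symmetric])
    finally show ?thesis .
  qed
  have "A (T x) = Z (T (K x))" for x
  proof -
    have "(\<lambda>j. (Z o\<^sub>L T) (k j x)) sums (Z o\<^sub>L T) (K x)"
      by (intro bounded_linear.sums[OF blinfun.bounded_linear_right]
          bounded_linear.sums[OF blinfun.bounded_linear_left] k)
    then have "(\<lambda>j. A (T (oproj (B j) e x))) sums Z (T (K x))"
      by (simp add: ZTk)
    moreover have "(\<Sum>j<m. A (T (oproj (B j) e x))) = A (T (oproj {..<n m} e x))" for m
      by (simp flip: oproj_blocks add: blinfun.sum_left blinfun.sum_right)
    ultimately have "(\<lambda>m. A (T (oproj {..<n m} e x))) \<longlonglongrightarrow> Z (T (K x))"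
      by (simp add: sums_def)
    \<comment> \<open>The partial sums run through the subsequence of projections ending at block
      boundaries, along which the truncations still converge to \<open>T\<close>.\<close>
    moreover have "(\<lambda>m. A (T (oproj {..<n m} e x))) \<longlonglongrightarrow> A (T x)"
    proof -
      have "(\<lambda>m. T - (T o\<^sub>L oproj {..<n m} e)) \<longlonglongrightarrow> 0"
        using LIMSEQ_subseq_LIMSEQ[OF T_lim mono] by (simp add: comp_def)
      then have "(\<lambda>m. A ((T - (T o\<^sub>L oproj {..<n m} e)) x)) \<longlonglongrightarrow> A (blinfun_apply 0 x)"
        by (intro tendsto_intros)
      then have "(\<lambda>m. A (T x) - A (T (oproj {..<n m} e x))) \<longlonglongrightarrow> 0"
        by (simp add: blinfun.diff_left blinfun.diff_right)
      from tendsto_diff[OF tendsto_const[of "A (T x)"] this] show ?thesis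
        by simp
    qed
    ultimately show ?thesis
      by (rule LIMSEQ_unique[symmetric])
  qed
  then have "(A o\<^sub>L T) = ((Z o\<^sub>L T) o\<^sub>L K)"
    by (intro blinfun_eqI) simp
  then show ?thesis
    using Z_ops K_ops by blast
qed

section \<open>Products with the ideal of compact operators\<close>

lemma ideal_productI: "X \<in> I \<Longrightarrow> Y \<in> J \<Longrightarrow> (X o\<^sub>L Y) \<in> ideal_product I J"
  unfolding ideal_product_def
  by (intro CollectI exI[of _ "1::nat"] exI[of _ "\<lambda>_. X"] exI[of _ "\<lambda>_. Y"]) simp

lemma ideal_product_zero: "0 \<in> ideal_product I J"
  unfolding ideal_product_def by (intro CollectI exI[of _ "0::nat"]) simp

lemma ideal_product_add_comp:
  assumes "P \<in> ideal_product I J" "X \<in> I" "Y \<in> J"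
  shows "P + (X o\<^sub>L Y) \<in> ideal_product I J"
proof -
  obtain n :: nat and U V where P: "P = (\<Sum>k<n. U k o\<^sub>L V k)" and UV: "\<forall>k<n. U k \<in> I \<and> V k \<in> J"
    using assms(1) unfolding ideal_product_def by blast
  have "P + (X o\<^sub>L Y) = (\<Sum>k<Suc n. (U(n := X)) k o\<^sub>L (V(n := Y)) k)"
    by (simp add: P)
  moreover have "\<forall>k<Suc n. (U(n := X)) k \<in> I \<and> (V(n := Y)) k \<in> J"
    using UV assms(2,3) by (simp add: less_Suc_eq)
  ultimately show ?thesis
    unfolding ideal_product_def by blast
qed

text \<open>Induction on the number of summands, so that closure properties can be checked one
  product at a time.\<close>

lemma ideal_product_induct [consumes 1, case_names zero add_comp]:
  assumes "P \<in> ideal_product I J" "Q 0"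
    and "\<And>P X Y. Q P \<Longrightarrow> X \<in> I \<Longrightarrow> Y \<in> J \<Longrightarrow> Q (P + (X o\<^sub>L Y))"
  shows "Q P"
proof -
  obtain n :: nat and U V where P: "P = (\<Sum>k<n. U k o\<^sub>L V k)" and UV: "\<forall>k<n. U k \<in> I \<and> V k \<in> J"
    using assms(1) unfolding ideal_product_def by blast
  have "m \<le> n \<Longrightarrow> Q (\<Sum>k<m. U k o\<^sub>L V k)" for m
    by (induction m) (use assms(2,3) UV in \<open>auto simp: Suc_le_eq\<close>)
  then show ?thesis
    unfolding P by blast
qed

text \<open>The left factor absorbs scalars and operators from the left; the right factor absorbs
  operators from the right, because compactness survives composition.\<close>

lemma two_sided_ideal_ideal_product:
  assumes I: "two_sided_ideal I"
  shows "two_sided_ideal (ideal_product I compact_ops)"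
proof -
  have sub: "csubspace I" and I_ops: "I \<subseteq> bounded_ops"
    and I_left: "\<And>A X. A \<in> bounded_ops \<Longrightarrow> X \<in> I \<Longrightarrow> (A o\<^sub>L X) \<in> I"
    using I by (auto simp: two_sided_ideal_def)
  have add: "P + R \<in> ideal_product I compact_ops"
    if "R \<in> ideal_product I compact_ops" "P \<in> ideal_product I compact_ops" for P R
    using that by (induction rule: ideal_product_induct)
      (auto simp: add.assoc[symmetric] intro: ideal_product_add_comp)
  have scale: "c *\<^sub>C P \<in> ideal_product I compact_ops" if "P \<in> ideal_product I compact_ops" for c P
    using that
  proof (induction rule: ideal_product_induct)
    case (add_comp P X Y)
    have "c *\<^sub>C (P + (X o\<^sub>L Y)) = c *\<^sub>C P + ((c *\<^sub>C X) o\<^sub>L Y)"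
      by (rule blinfun_eqI) (simp add: scaleC_blinfun.rep_eq blinfun.add_left scaleC_add_right)
    then show ?case
      using add_comp complex_vector.subspace_scale[OF sub] by (simp add: ideal_product_add_comp)
  qed (simp add: ideal_product_zero)
  have bounded: "P \<in> bounded_ops" if "P \<in> ideal_product I compact_ops" for P
    using that
  proof (induction rule: ideal_product_induct)
    case (add_comp P X Y)
    then have "(X o\<^sub>L Y) \<in> bounded_ops"
      using I_ops compact_ops_bounded_ops by (auto intro: compose_in_bounded_ops)
    with add_comp show ?case
      by (simp add: complex_vector.subspace_add[OF csubspace_bounded_ops])
  qed (simp add: complex_vector.subspace_0 csubspace_bounded_ops)
  have left: "(A o\<^sub>L P) \<in> ideal_product I compact_ops"
    if "P \<in> ideal_product I compact_ops" "A \<in> bounded_ops" for A P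
    using that(1)
  proof (induction rule: ideal_product_induct)
    case (add_comp P X Y)
    have "(A o\<^sub>L (P + (X o\<^sub>L Y))) = (A o\<^sub>L P) + ((A o\<^sub>L X) o\<^sub>L Y)"
      by (rule blinfun_eqI) (simp add: blinfun.add_left blinfun.add_right)
    then show ?case
      using add_comp I_left[OF that(2)] by (simp add: ideal_product_add_comp)
  qed (simp add: ideal_product_zero)
  have right: "(P o\<^sub>L A) \<in> ideal_product I compact_ops"
    if "P \<in> ideal_product I compact_ops" "A \<in> bounded_ops" for A P
    using that(1)
  proof (induction rule: ideal_product_induct)
    case (add_comp P X Y)
    have "((P + (X o\<^sub>L Y)) o\<^sub>L A) = (P o\<^sub>L A) + (X o\<^sub>L (Y o\<^sub>L A))"
      by (rule blinfun_eqI) (simp add: blinfun.add_left)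
    then show ?case
      using add_comp compact_ops_comp_right[OF _ that(2)] by (simp add: ideal_product_add_comp)
  qed (simp add: ideal_product_zero)
  show ?thesis
    unfolding two_sided_ideal_def complex_vector.subspace_def
    by (intro conjI ballI allI subsetI) (simp_all add: add scale bounded left right ideal_product_zero)
qed

text \<open>Minimality of the principal ideal reduces softness to the generator. Read
  contrapositively, a non-soft principal ideal has its generator outside the product.\<close>

lemma soft_principal_idealI:
  assumes T: "T \<in> bounded_ops" "T \<in> ideal_product (principal_ideal T) compact_ops"
  shows "soft_ideal (principal_ideal T)"
proof -
  have I: "two_sided_ideal (principal_ideal T)"
    using T(1) by (rule two_sided_ideal_principal_ideal)
  have "principal_ideal T \<subseteq> ideal_product (principal_ideal T) compact_ops"
    by (subst (1) principal_ideal_def)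
      (intro hull_minimal two_sided_ideal_ideal_product I, use T(2) in simp)
  moreover have "P \<in> principal_ideal T" if "P \<in> ideal_product (principal_ideal T) compact_ops" for P
    using that
  proof (induction rule: ideal_product_induct)
    case zero
    then show ?case
      using I by (simp add: two_sided_ideal_def complex_vector.subspace_0)
  next
    case (add_comp P X Y)
    then have "(X o\<^sub>L Y) \<in> principal_ideal T"
      using I compact_ops_bounded_ops unfolding two_sided_ideal_def by blast
    with add_comp show ?case
      using I by (simp add: two_sided_ideal_def complex_vector.subspace_add)
  qed
  ultimately show ?thesis
    using I by (auto simp: soft_ideal_def)
qed

text \<open>\<open>T o\<^sub>L A\<close> is such a product as it stands;
  \<open>A o\<^sub>L T\<close> has its compact factor on the wrong side and needs the
  factorization.\<close>

lemma comp_principal_in_ideal_product: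
  assumes "A \<in> compact_ops" "T \<in> compact_ops"
  shows "(A o\<^sub>L T) \<in> ideal_product (principal_ideal T) compact_ops"
    and "(T o\<^sub>L A) \<in> ideal_product (principal_ideal T) compact_ops"
proof -
  have I: "two_sided_ideal (principal_ideal T)"
    using assms(2) by (intro two_sided_ideal_principal_ideal compact_ops_bounded_ops)
  have T: "T \<in> principal_ideal T"
    unfolding principal_ideal_def using hull_subset[of "{T}" two_sided_ideal] by simp
  then show "(T o\<^sub>L A) \<in> ideal_product (principal_ideal T) compact_ops"
    using assms(1) by (rule ideal_productI)
  obtain Z K where ZK: "Z \<in> bounded_ops" "K \<in> compact_ops" "(A o\<^sub>L T) = ((Z o\<^sub>L T) o\<^sub>L K)"
    using compact_comp_factorization[OF assms] by blast
  have "(Z o\<^sub>L T) \<in> principal_ideal T"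
    using I T ZK(1) by (simp add: two_sided_ideal_def)
  then show "(A o\<^sub>L T) \<in> ideal_product (principal_ideal T) compact_ops"
    using ZK by (simp add: ideal_productI)
qed

section \<open>Lie ideals: traces of two-sided ideals and the center\<close>

lemma lie_ideal_Int_two_sided_ideal:
  assumes L: "lie_algebra_of_compact_ops L" and S: "two_sided_ideal S"
  shows "lie_ideal (L \<inter> S) L"
proof -
  have "commutator A B \<in> S" if "A \<in> L" "B \<in> S" for A B
  proof -
    have "A \<in> bounded_ops"
      using L that(1) compact_ops_bounded_ops by (auto simp: lie_algebra_of_compact_ops_def)
    then show ?thesis
      using S that(2) by (auto simp: commutator_def two_sided_ideal_def
          intro: complex_vector.subspace_diff)
  qed
  then show ?thesis
    using L S by (auto simp: lie_ideal_def lie_algebra_of_compact_ops_def two_sided_ideal_def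
        intro: complex_vector.subspace_inter)
qed

lemma lie_ideal_center:
  assumes L: "lie_algebra_of_compact_ops L"
  shows "lie_ideal {B \<in> L. \<forall>A\<in>L. commutator A B = 0} L"
proof -
  have sub: "csubspace L"
    using L by (simp add: lie_algebra_of_compact_ops_def)
  have L_scaleC: "A (c *\<^sub>C x) = c *\<^sub>C A x" if "A \<in> L" for A c x
    using L that compact_ops_bounded_ops
    by (intro bounded_ops_scaleC) (auto simp: lie_algebra_of_compact_ops_def)
  have [simp]: "commutator A 0 = 0" for A :: "'a \<Rightarrow>\<^sub>L 'a"
    by (rule blinfun_eqI) (simp add: commutator_def blinfun.diff_left)
  have add: "commutator A (B + C) = commutator A B + commutator A C" for A B C :: "'a \<Rightarrow>\<^sub>L 'a"
    by (rule blinfun_eqI)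
      (simp add: commutator_def blinfun.diff_left blinfun.add_left blinfun.add_right)
  \<comment> \<open>Pulling \<open>c\<close> through \<open>A\<close> uses the complex linearity of
    \<open>A\<close>, hence the restriction to \<open>L\<close>.\<close>
  have scale: "commutator A (c *\<^sub>C B) = c *\<^sub>C commutator A B" if "A \<in> L" for c A B
    by (rule blinfun_eqI)
      (simp add: commutator_def blinfun.diff_left scaleC_blinfun.rep_eq L_scaleC[OF that]
        complex_vector.scale_right_diff_distrib)
  have "csubspace {B \<in> L. \<forall>A\<in>L. commutator A B = 0}"
    using sub by (auto simp: complex_vector.subspace_def add scale)
  then show ?thesis
    using sub by (auto simp: lie_ideal_def complex_vector.subspace_0)
qed

theorem theorem3p5:
  fixes L :: "('a::chilbert_space \<Rightarrow>\<^sub>L 'a) set"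
  assumes "separable_space (euclidean :: 'a topology)"
    and "infinite_cdim (UNIV :: 'a set)"
    and "lie_algebra_of_compact_ops L"
    and "infinite_cdim L"
    and "nonabelian L"
    and "\<exists>T\<in>L. \<not> soft_ideal (principal_ideal T)"
  shows "\<not> lie_simple L"
proof
  assume simple: "lie_simple L"
  obtain T where T: "T \<in> L" "\<not> soft_ideal (principal_ideal T)"
    using assms(6) by blast
  have L_ops: "A \<in> compact_ops" if "A \<in> L" for A
    using assms(3) that by (auto simp: lie_algebra_of_compact_ops_def)
  define S where "S = ideal_product (principal_ideal T) compact_ops"
  have T_ops: "T \<in> bounded_ops"
    using L_ops[OF T(1)] by (rule compact_ops_bounded_ops)
  then have S: "two_sided_ideal S"
    unfolding S_def by (intro two_sided_ideal_ideal_product two_sided_ideal_principal_ideal)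
  have "T \<notin> S"
    using soft_principal_idealI[OF T_ops] T(2) by (auto simp: S_def)
  \<comment> \<open>The Lie ideal \<open>L \<inter> S\<close> misses \<open>T\<close>, so it is not
    \<open>L\<close>, and simplicity leaves only the zero ideal.\<close>
  then have LS: "L \<inter> S = {0}"
    using simple lie_ideal_Int_two_sided_ideal[OF assms(3) S] T(1)
    unfolding lie_simple_def by blast
  have "commutator A T = 0" if A: "A \<in> L" for A
  proof -
    have "commutator A T \<in> S"
      unfolding commutator_def S_def
      using S comp_principal_in_ideal_product[OF L_ops[OF A] L_ops[OF T(1)]]
      by (auto simp: two_sided_ideal_def S_def intro: complex_vector.subspace_diff)
    moreover have "commutator A T \<in> L"
      using assms(3) A T(1) by (simp add: lie_algebra_of_compact_ops_def)
    ultimately show ?thesis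
      using LS by blast
  qed
  then have "T \<in> {B \<in> L. \<forall>A\<in>L. commutator A B = 0}"
    using T(1) by simp
  \<comment> \<open>\<open>S\<close> contains 0 but not \<open>T\<close>. Hence the center is
    nonzero, and simplicity makes it all of \<open>L\<close>.\<close>
  moreover have "T \<noteq> 0"
    using \<open>T \<notin> S\<close> S by (auto simp: two_sided_ideal_def complex_vector.subspace_0)
  ultimately have "{B \<in> L. \<forall>A\<in>L. commutator A B = 0} = L"
    using simple lie_ideal_center[OF assms(3)] unfolding lie_simple_def by blast
  then show False
    using assms(5) unfolding nonabelian_def by blast
qed

end
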